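(* Suppose $0<1/n \ll \epsilon \ll d\leq 1$. Let $G[U,W]$ be an $(\epsilon,d)$-super-regular bipartite graph with $|U|=|W|=n$. Then for every edge $e\in E(G)$, $$\frac{|M_e(G)|}{|M(G)|} = (1\pm \epsilon^{1/20}) \frac{1}{dn}. $$ In other words, if we choose a perfect matching $\sigma$ of $G$ uniformly at random, then for any edge $uv\in E(G)$ with $u\in U$ and $v\in W$, $\mathbb{P}[ \sigma(u)=v ] = (1\pm \epsilon^{1/20}) \frac{1}{dn}.$
   Context: $M(G)$ denotes the set of perfect matchings of $G$ and $M_e(G)$ the set of perfect matchings containing the edge $e$; a perfect matching $\sigma$ is viewed as a bijection $U\to W$. Hierarchy convention: a statement holding whenever $0<1/n\ll a\ll b\le 1$ means there are non-decreasing functions such that it holds whenever each constant is at most the appropriate function of the constants to its right. A bipartite graph $G$ with classes $U,W$ is $(\epsilon,d)$-regular if for all $U'\subseteq U$, $W'\subseteq W$ with $|U'|>\epsilon|U|$, $|W'|>\epsilon|W|$ we have $e(G[U',W'])/(|U'||W'|)=d\pm\epsilon$; it is $(\epsilon,d)$-super-regular if moreover every vertex of $U$ has degree $(d\pm\epsilon)|W|$ and every vertex of $W$ has degree $(d\pm\epsilon)|U|$. Here $a=b\pm c$ means $b-c\le a\le b+c$. *)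

theory Defs
  imports "HOL-Probability.Probability"
begin

(* A bipartite graph with ordered classes U, W is given by its set of edges E, where the edge uw
   with u in U and w in W is the pair (u, w).  The classes are disjoint by construction, even if
   'a and 'b are instantiated to the same type. *)
definition bipartite_graph :: "'a set \<Rightarrow> 'b set \<Rightarrow> ('a \<times> 'b) set \<Rightarrow> bool" where
  "bipartite_graph U W E \<longleftrightarrow> finite U \<and> finite W \<and> E \<subseteq> U \<times> W"

(* a = b \<plusminus> c *)
definition eq_up_to :: "real \<Rightarrow> real \<Rightarrow> real \<Rightarrow> bool" where
  "eq_up_to a b c \<longleftrightarrow> b - c \<le> a \<and> a \<le> b + c"

definition edges_between :: "('a \<times> 'b) set \<Rightarrow> 'a set \<Rightarrow> 'b set \<Rightarrow> ('a \<times> 'b) set" where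
  "edges_between E U' W' = {(u, w) \<in> E. u \<in> U' \<and> w \<in> W'}"

definition regular_pair ::
  "real \<Rightarrow> real \<Rightarrow> 'a set \<Rightarrow> 'b set \<Rightarrow> ('a \<times> 'b) set \<Rightarrow> bool" where
  "regular_pair \<epsilon> d U W E \<longleftrightarrow>
     bipartite_graph U W E \<and>
     (\<forall>U' W'. U' \<subseteq> U \<and> W' \<subseteq> W \<and>
        real (card U') > \<epsilon> * real (card U) \<and> real (card W') > \<epsilon> * real (card W) \<longrightarrow>
        eq_up_to (real (card (edges_between E U' W')) / (real (card U') * real (card W'))) d \<epsilon>)"

definition super_regular_pair ::
  "real \<Rightarrow> real \<Rightarrow> 'a set \<Rightarrow> 'b set \<Rightarrow> ('a \<times> 'b) set \<Rightarrow> bool" where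
  "super_regular_pair \<epsilon> d U W E \<longleftrightarrow>
     regular_pair \<epsilon> d U W E \<and>
     (\<forall>u\<in>U. (d - \<epsilon>) * real (card W) \<le> real (card {w. (u, w) \<in> E}) \<and>
            real (card {w. (u, w) \<in> E}) \<le> (d + \<epsilon>) * real (card W)) \<and>
     (\<forall>w\<in>W. (d - \<epsilon>) * real (card U) \<le> real (card {u. (u, w) \<in> E}) \<and>
            real (card {u. (u, w) \<in> E}) \<le> (d + \<epsilon>) * real (card U))"

definition perfect_matchings ::
  "'a set \<Rightarrow> 'b set \<Rightarrow> ('a \<times> 'b) set \<Rightarrow> ('a \<times> 'b) set set" where
  "perfect_matchings U W E =
     {M. M \<subseteq> E \<and> (\<forall>u\<in>U. \<exists>!e. e \<in> M \<and> fst e = u) \<and> (\<forall>w\<in>W. \<exists>!e. e \<in> M \<and> snd e = w)}"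

definition perfect_matchings_containing ::
  "'a \<times> 'b \<Rightarrow> 'a set \<Rightarrow> 'b set \<Rightarrow> ('a \<times> 'b) set \<Rightarrow> ('a \<times> 'b) set set" where
  "perfect_matchings_containing e U W E = {M \<in> perfect_matchings U W E. e \<in> M}"

(* A perfect matching regarded as a function; its values are only meaningful on U. *)
definition matching_fun :: "('a \<times> 'b) set \<Rightarrow> 'a \<Rightarrow> 'b" where
  "matching_fun M u = (THE v. (u, v) \<in> M)"

lemma matching_fun_bij_betw:
  assumes E: "bipartite_graph U W E" and M: "M \<in> perfect_matchings U W E"
  shows "bij_betw (matching_fun M) U W"
    and "u \<in> U \<Longrightarrow> matching_fun M u = v \<longleftrightarrow> (u, v) \<in> M"
proof -
  have sub: "M \<subseteq> U \<times> W"
    using E M by (auto simp: bipartite_graph_def perfect_matchings_def)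
  have u1: "\<exists>!v. (u, v) \<in> M" if "u \<in> U" for u
  proof -
    have "\<exists>!e. e \<in> M \<and> fst e = u" using M that by (auto simp: perfect_matchings_def)
    then show ?thesis by (metis fst_conv prod.collapse snd_conv)
  qed
  have w1: "\<exists>!u. (u, w) \<in> M" if "w \<in> W" for w
  proof -
    have "\<exists>!e. e \<in> M \<and> snd e = w" using M that by (auto simp: perfect_matchings_def)
    then show ?thesis by (metis fst_conv prod.collapse snd_conv)
  qed
  have eq: "matching_fun M u = v \<longleftrightarrow> (u, v) \<in> M" if "u \<in> U" for u v
    using theI'[OF u1[OF that]] u1[OF that] unfolding matching_fun_def by blast
  show "u \<in> U \<Longrightarrow> matching_fun M u = v \<longleftrightarrow> (u, v) \<in> M" by (rule eq)
  show "bij_betw (matching_fun M) U W"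
  proof (rule bij_betw_imageI)
    show "inj_on (matching_fun M) U"
      by (rule inj_onI) (metis eq sub w1 mem_Sigma_iff subsetD)
    show "matching_fun M ` U = W"
    proof
      show "matching_fun M ` U \<subseteq> W" using eq sub by blast
      show "W \<subseteq> matching_fun M ` U"
        by (metis eq image_eqI mem_Sigma_iff sub subsetD subsetI w1)
    qed
  qed
qed

end

theory Submission
  imports Defs
begin

text \<open>A perfect matching, viewed as a bijection \<open>\<sigma>\<close> from \<open>U\<close> to \<open>W\<close>, defines a digraph on \<open>U\<close> with
  an arc from \<open>x\<close> to \<open>y\<close> whenever \<open>(x, \<sigma> y)\<close> is an edge, and this digraph inherits super-regularity.
  If \<open>\<sigma> u = v\<close>, composing \<open>\<sigma>\<close> with a cycle \<open>u \<rightarrow> a \<rightarrow> b \<rightarrow> c \<rightarrow> u\<close> of this digraph gives a perfect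
  matching \<open>\<tau>\<close> with \<open>\<tau> c = v\<close>; it is undone along a path \<open>c \<rightarrow> b \<rightarrow> a \<rightarrow> u\<close> in the digraph of \<open>\<tau>\<close>.
  Cycles of length four are just long enough for regularity to determine both counts for every
  single matching: there are about \<open>d\<^sup>4 n\<^sup>3\<close> such cycles through \<open>u\<close>, and about \<open>d\<^sup>3 n\<^sup>2\<close> such paths.
  Double counting gives the ratio \<open>1 / (d n)\<close> between the matchings with and without \<open>uv\<close>.\<close>

section \<open>Counting cycles and paths in super-regular digraphs\<close>

definition four_cycles :: "'a set \<Rightarrow> ('a \<Rightarrow> 'a \<Rightarrow> bool) \<Rightarrow> 'a \<Rightarrow> ('a \<times> 'a \<times> 'a) set" where
  "four_cycles U D u = {(a, b, c). a \<in> U \<and> b \<in> U \<and> c \<in> U \<and> distinct [u, a, b, c] \<and>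
     D u a \<and> D a b \<and> D b c \<and> D c u}"

text \<open>The inner vertices of the path from \<open>c\<close> over \<open>b\<close> and
  \<open>a\<close> to \<open>u\<close> are listed against its direction, to agree with the first two
  entries of the cycle that the path undoes.\<close>

definition three_paths :: "'a set \<Rightarrow> ('a \<Rightarrow> 'a \<Rightarrow> bool) \<Rightarrow> 'a \<Rightarrow> 'a \<Rightarrow> ('a \<times> 'a) set" where
  "three_paths U D c u = {(a, b). a \<in> U \<and> b \<in> U \<and> distinct [u, a, b, c] \<and>
     D c b \<and> D b a \<and> D a u}"

text \<open>Loops are allowed: in the digraph of a perfect matching every vertex carries one. The
  bound \<open>2 * \<epsilon> < d\<close> makes all neighbourhoods larger than
  \<open>\<epsilon> * card U\<close>, so that regularity applies to them.\<close>

locale super_regular_digraph =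
  fixes U :: "'a set" and D :: "'a \<Rightarrow> 'a \<Rightarrow> bool" and \<epsilon> d :: real
  assumes finite_U: "finite U"
    and nonempty_U: "U \<noteq> {}"
    and eps_pos: "0 < \<epsilon>"
    and two_eps_less: "2 * \<epsilon> < d"
    and d_le_1: "d \<le> 1"
    and out_degree: "x \<in> U \<Longrightarrow> real (card {y\<in>U. D x y}) \<in> {(d - \<epsilon>) * card U .. (d + \<epsilon>) * card U}"
    and in_degree: "y \<in> U \<Longrightarrow> real (card {x\<in>U. D x y}) \<in> {(d - \<epsilon>) * card U .. (d + \<epsilon>) * card U}"
    and regular: "\<lbrakk>X \<subseteq> U; Y \<subseteq> U; \<epsilon> * card U < card X; \<epsilon> * card U < card Y\<rbrakk> \<Longrightarrow>
      real (card {(x, y) \<in> X \<times> Y. D x y}) \<in>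
        {(d - \<epsilon>) * (card X * card Y) .. (d + \<epsilon>) * (card X * card Y)}"
begin

lemma card_U_pos: "0 < card U"
  using finite_U nonempty_U by (simp add: card_gt_0_iff)

lemma out_degree_large: "x \<in> U \<Longrightarrow> \<epsilon> * card U < card {y\<in>U. D x y}"
proof -
  assume "x \<in> U"
  have "\<epsilon> * card U < (d - \<epsilon>) * card U"
    using two_eps_less card_U_pos by simp
  then show ?thesis using out_degree[OF \<open>x \<in> U\<close>] by simp
qed

lemma in_degree_large: "y \<in> U \<Longrightarrow> \<epsilon> * card U < card {x\<in>U. D x y}"
proof -
  assume "y \<in> U"
  have "\<epsilon> * card U < (d - \<epsilon>) * card U"
    using two_eps_less card_U_pos by simp
  then show ?thesis using in_degree[OF \<open>y \<in> U\<close>] by simp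
qed

text \<open>Reversal turns bounds on in-degrees from a large set into bounds on out-degrees into a
  large set; the count of two-paths uses both.\<close>

lemma converse_digraph: "super_regular_digraph U (\<lambda>x y. D y x) \<epsilon> d"
proof
  fix X Y assume XY: "X \<subseteq> U" "Y \<subseteq> U" "\<epsilon> * card U < card X" "\<epsilon> * card U < card Y"
  have "bij_betw prod.swap {(x, y) \<in> X \<times> Y. D y x} {(x, y) \<in> Y \<times> X. D x y}"
    by (rule bij_betw_byWitness[where f' = prod.swap]) auto
  then show "real (card {(x, y) \<in> X \<times> Y. D y x}) \<in>
        {(d - \<epsilon>) * (card X * card Y) .. (d + \<epsilon>) * (card X * card Y)}"
    using regular[of Y X] XY by (simp add: bij_betw_same_card mult.commute)
qed (use finite_U nonempty_U eps_pos two_eps_less d_le_1 out_degree in_degree in auto)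

lemma card_pairs: "finite X \<Longrightarrow> finite Y \<Longrightarrow> card {(x, y) \<in> X \<times> Y. D x y} = (\<Sum>y\<in>Y. card {x\<in>X. D x y})"
proof -
  assume fin: "finite X" "finite Y"
  have "bij_betw prod.swap (SIGMA y:Y. {x\<in>X. D x y}) {(x, y) \<in> X \<times> Y. D x y}"
    by (rule bij_betw_byWitness[where f' = prod.swap]) auto
  then have "card {(x, y) \<in> X \<times> Y. D x y} = card (SIGMA y:Y. {x\<in>X. D x y})"
    by (simp add: bij_betw_same_card)
  then show ?thesis using fin by simp
qed

text \<open>More than \<open>\<epsilon> * card U\<close> exceptional vertices would form a set to
  which regularity applies together with \<open>A\<close>, yet their in-degrees would add up to more
  arcs than it permits. The low case is symmetric.\<close>

lemma card_high_in_degree: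
  assumes A: "A \<subseteq> U" "\<epsilon> * card U < card A"
  shows "card {b\<in>U. (d + \<epsilon>) * card A < card {a\<in>A. D a b}} \<le> \<epsilon> * card U"
proof (rule ccontr)
  let ?X = "{b\<in>U. (d + \<epsilon>) * card A < card {a\<in>A. D a b}}"
  assume "\<not> card ?X \<le> \<epsilon> * card U"
  then have large: "\<epsilon> * card U < card ?X" by simp
  have fin: "finite A" "finite ?X" using A finite_U by (auto intro: finite_subset)
  \<comment> \<open>Summation keeps the inequality strict only over a non-empty set.\<close>
  have "?X \<noteq> {}" using large eps_pos card_U_pos by (intro notI) (simp add: mult_less_0_iff)
  then have "(\<Sum>b\<in>?X. (d + \<epsilon>) * card A) < (\<Sum>b\<in>?X. real (card {a\<in>A. D a b}))"
    using fin by (intro sum_strict_mono) auto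
  moreover have "(\<Sum>b\<in>?X. real (card {a\<in>A. D a b})) = card {(a, b) \<in> A \<times> ?X. D a b}"
    unfolding card_pairs[OF fin] by simp
  ultimately show False
    using regular[of A ?X] A large by (simp add: algebra_simps)
qed

lemma card_low_in_degree:
  assumes A: "A \<subseteq> U" "\<epsilon> * card U < card A"
  shows "card {b\<in>U. card {a\<in>A. D a b} < (d - \<epsilon>) * card A} \<le> \<epsilon> * card U"
proof (rule ccontr)
  let ?X = "{b\<in>U. card {a\<in>A. D a b} < (d - \<epsilon>) * card A}"
  assume "\<not> card ?X \<le> \<epsilon> * card U"
  then have large: "\<epsilon> * card U < card ?X" by simp
  have fin: "finite A" "finite ?X" using A finite_U by (auto intro: finite_subset)
  have "?X \<noteq> {}" using large eps_pos card_U_pos by (intro notI) (simp add: mult_less_0_iff)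
  then have "(\<Sum>b\<in>?X. (d - \<epsilon>) * card A) > (\<Sum>b\<in>?X. real (card {a\<in>A. D a b}))"
    using fin by (intro sum_strict_mono) auto
  moreover have "(\<Sum>b\<in>?X. real (card {a\<in>A. D a b})) = card {(a, b) \<in> A \<times> ?X. D a b}"
    unfolding card_pairs[OF fin] by simp
  ultimately show False
    using regular[of A ?X] A large by (simp add: algebra_simps)
qed

lemma card_two_paths:
  assumes "finite A" "finite C"
  shows "card {(a, b, c) \<in> A \<times> U \<times> C. D a b \<and> D b c} =
    (\<Sum>b\<in>U. card {a\<in>A. D a b} * card {c\<in>C. D b c})"
proof -
  have "bij_betw (\<lambda>(b, a, c). (a, b, c)) (SIGMA b:U. {a\<in>A. D a b} \<times> {c\<in>C. D b c})
      {(a, b, c) \<in> A \<times> U \<times> C. D a b \<and> D b c}"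
    by (rule bij_betw_byWitness[where f' = "\<lambda>(a, b, c). (b, a, c)"]) auto
  then have "card {(a, b, c) \<in> A \<times> U \<times> C. D a b \<and> D b c} =
      card (SIGMA b:U. {a\<in>A. D a b} \<times> {c\<in>C. D b c})"
    by (simp add: bij_betw_same_card)
  then show ?thesis using assms finite_U by (simp add: card_cartesian_product)
qed

text \<open>A middle vertex typical for both \<open>A\<close> and \<open>C\<close> lies on about
  \<open>d ^ 2 * card A * card C\<close> two-paths. At most \<open>\<epsilon> * card U\<close>
  vertices are exceptional for each of the two sets, whence the terms
  \<open>2 * \<epsilon>\<close>.\<close>

lemma card_two_paths_bounds:
  assumes A: "A \<subseteq> U" "\<epsilon> * card U < card A" and C: "C \<subseteq> U" "\<epsilon> * card U < card C"
  shows "real (card {(a, b, c) \<in> A \<times> U \<times> C. D a b \<and> D b c}) \<in>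
    {(1 - 2 * \<epsilon>) * (d - \<epsilon>)\<^sup>2 * (card A * card C * card U) ..
     ((d + \<epsilon>)\<^sup>2 + 2 * \<epsilon>) * (card A * card C * card U)}"
proof -
  interpret conv: super_regular_digraph U "\<lambda>x y. D y x" \<epsilon> d
    by (rule converse_digraph)
  define p where "p b = real (card {a\<in>A. D a b})" for b
  define q where "q b = real (card {c\<in>C. D b c})" for b
  have fin: "finite A" "finite C" using A C finite_U finite_subset by auto
  have p: "0 \<le> p b" "p b \<le> card A" for b
    unfolding p_def using fin by (auto intro!: card_mono)
  have q: "0 \<le> q b" "q b \<le> card C" for b
    unfolding q_def using fin by (auto intro!: card_mono)
  have count: "real (card {(a, b, c) \<in> A \<times> U \<times> C. D a b \<and> D b c}) = (\<Sum>b\<in>U. p b * q b)"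
    using card_two_paths[OF fin] by (simp add: p_def q_def)
  \<comment> \<open>Only degrees that are too high can spoil the upper bound and only those too low
    the lower one, so each bound has its own exceptional set.\<close>
  define H where "H = {b\<in>U. (d + \<epsilon>) * card A < p b} \<union> {b\<in>U. (d + \<epsilon>) * card C < q b}"
  define L where "L = {b\<in>U. p b < (d - \<epsilon>) * card A} \<union> {b\<in>U. q b < (d - \<epsilon>) * card C}"
  have H: "card H \<le> 2 * \<epsilon> * card U"
    using card_Un_le[of "{b\<in>U. (d + \<epsilon>) * card A < p b}" "{b\<in>U. (d + \<epsilon>) * card C < q b}"]
      card_high_in_degree[OF A] conv.card_high_in_degree[OF C]
    unfolding H_def p_def q_def by linarith
  have L: "card L \<le> 2 * \<epsilon> * card U"
    using card_Un_le[of "{b\<in>U. p b < (d - \<epsilon>) * card A}" "{b\<in>U. q b < (d - \<epsilon>) * card C}"]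
      card_low_in_degree[OF A] conv.card_low_in_degree[OF C]
    unfolding L_def p_def q_def by linarith
  have sub: "H \<subseteq> U" "L \<subseteq> U" by (auto simp: H_def L_def)
  \<comment> \<open>An exceptional vertex is charged the trivial bound on top of the typical one,
    which leaves the sum over \<open>U\<close> in one piece.\<close>
  have "(\<Sum>b\<in>U. p b * q b) \<le>
      (\<Sum>b\<in>U. (d + \<epsilon>)\<^sup>2 * (card A * card C) + (if b \<in> H then real (card A * card C) else 0))"
  proof (rule sum_mono)
    fix b assume b: "b \<in> U"
    show "p b * q b \<le> (d + \<epsilon>)\<^sup>2 * (card A * card C) + (if b \<in> H then real (card A * card C) else 0)"
    proof (cases "b \<in> H")
      case True
      have "p b * q b \<le> card A * card C" using p q by (simp add: mult_mono)
      moreover have "0 \<le> (d + \<epsilon>)\<^sup>2 * (card A * card C)" by simp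
      ultimately show ?thesis unfolding if_P[OF True] by linarith
    next
      case False
      then have "p b \<le> (d + \<epsilon>) * card A" "q b \<le> (d + \<epsilon>) * card C"
        using b by (auto simp: H_def)
      then have "p b * q b \<le> ((d + \<epsilon>) * card A) * ((d + \<epsilon>) * card C)"
        using p q eps_pos two_eps_less by (intro mult_mono) auto
      then show ?thesis using False by (simp add: power2_eq_square algebra_simps)
    qed
  qed
  also have "\<dots> = (d + \<epsilon>)\<^sup>2 * (card A * card C) * card U + card H * (card A * card C)"
    using finite_U sub by (simp add: sum.distrib sum.If_cases Int_absorb1)
  also have "\<dots> \<le> (d + \<epsilon>)\<^sup>2 * (card A * card C) * card U + 2 * \<epsilon> * card U * (card A * card C)"
    using mult_right_mono[OF H, of "card A * card C"] by simp
  finally have upper: "(\<Sum>b\<in>U. p b * q b) \<le> ((d + \<epsilon>)\<^sup>2 + 2 * \<epsilon>) * (card A * card C * card U)"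
    by (simp add: algebra_simps)
  \<comment> \<open>For the lower bound the vertices of \<open>L\<close> are discarded
    altogether.\<close>
  have "(1 - 2 * \<epsilon>) * card U \<le> card (U - L)"
    using L sub finite_U card_mono[OF finite_U sub(2)]
    by (simp add: card_Diff_subset finite_subset of_nat_diff algebra_simps)
  then have "(1 - 2 * \<epsilon>) * card U * ((d - \<epsilon>)\<^sup>2 * (card A * card C)) \<le>
      card (U - L) * ((d - \<epsilon>)\<^sup>2 * (card A * card C))"
    by (rule mult_right_mono) simp
  also have "\<dots> = (\<Sum>b\<in>U - L. ((d - \<epsilon>) * card A) * ((d - \<epsilon>) * card C))"
    by (simp add: power2_eq_square algebra_simps)
  also have "\<dots> \<le> (\<Sum>b\<in>U - L. p b * q b)"
    using p q eps_pos two_eps_less by (intro sum_mono mult_mono) (auto simp: L_def)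
  also have "\<dots> \<le> (\<Sum>b\<in>U. p b * q b)"
    using finite_U p q by (intro sum_mono2) auto
  finally have "(1 - 2 * \<epsilon>) * (d - \<epsilon>)\<^sup>2 * (card A * card C * card U) \<le> (\<Sum>b\<in>U. p b * q b)"
    by (simp add: algebra_simps)
  with upper count show ?thesis by simp
qed

text \<open>Removing \<open>u\<close> from a four-cycle leaves a two-path from the out-neighbourhood
  to the in-neighbourhood of \<open>u\<close>, both of size about \<open>d * n\<close>. Degenerate
  two-paths only cost a term of order \<open>n ^ 2\<close> in the lower bound.\<close>

lemma card_four_cycles:
  assumes u: "u \<in> U"
  shows "real (card (four_cycles U D u)) \<in>
    {(1 - 2 * \<epsilon>) * (d - \<epsilon>) ^ 4 * real (card U) ^ 3 - 6 * real (card U) ^ 2 ..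
     ((d + \<epsilon>)\<^sup>2 + 2 * \<epsilon>) * (d + \<epsilon>)\<^sup>2 * real (card U) ^ 3}"
proof -
  define n where "n = card U"
  define A where "A = {y\<in>U. D u y}"
  define C where "C = {x\<in>U. D x u}"
  define Z where "Z = {(a, b, c) \<in> A \<times> U \<times> C. D a b \<and> D b c}"
  have A: "A \<subseteq> U" "\<epsilon> * card U < card A"
      and C: "C \<subseteq> U" "\<epsilon> * card U < card C"
    using out_degree_large[OF u] in_degree_large[OF u] by (auto simp: A_def C_def)
  have cA: "(d - \<epsilon>) * n \<le> card A" "card A \<le> (d + \<epsilon>) * n"
    and cC: "(d - \<epsilon>) * n \<le> card C" "card C \<le> (d + \<epsilon>) * n"
    using out_degree[OF u] in_degree[OF u] by (auto simp: A_def C_def n_def)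
  note Z = card_two_paths_bounds[OF A C, folded Z_def n_def]
  have fin: "finite A" "finite C" using A C finite_U finite_subset by auto
  have finZ: "finite Z" unfolding Z_def
    by (rule finite_subset[of _ "A \<times> U \<times> C"]) (use fin finite_U in auto)
  have "four_cycles U D u \<subseteq> Z" by (auto simp: four_cycles_def Z_def A_def C_def)
  then have "real (card (four_cycles U D u)) \<le> card Z" using finZ by (simp add: card_mono)
  also have "\<dots> \<le> ((d + \<epsilon>)\<^sup>2 + 2 * \<epsilon>) * (card A * card C * n)" using Z by simp
  also have "\<dots> \<le> ((d + \<epsilon>)\<^sup>2 + 2 * \<epsilon>) * (((d + \<epsilon>) * n) * ((d + \<epsilon>) * n) * n)"
    unfolding of_nat_mult using cA cC eps_pos two_eps_less by (intro mult_left_mono mult_right_mono mult_mono) auto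
  also have "\<dots> = ((d + \<epsilon>)\<^sup>2 + 2 * \<epsilon>) * (d + \<epsilon>)\<^sup>2 * real n ^ 3"
    by (simp add: power2_eq_square power3_eq_cube)
  finally have upper: "real (card (four_cycles U D u)) \<le> \<dots>" .
  \<comment> \<open>One family for each of the six coincidences among \<open>u\<close>,
    \<open>a\<close>, \<open>b\<close>, \<open>c\<close>, with two vertices left free.\<close>
  define bad where "bad = (\<lambda>(x, y). (u, x, y)) ` (U \<times> U) \<union> (\<lambda>(x, y). (x, u, y)) ` (U \<times> U) \<union>
    (\<lambda>(x, y). (x, y, u)) ` (U \<times> U) \<union> (\<lambda>(x, y). (x, x, y)) ` (U \<times> U) \<union>
    (\<lambda>(x, y). (x, y, x)) ` (U \<times> U) \<union> (\<lambda>(x, y). (x, y, y)) ` (U \<times> U)"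
  have img: "card (f ` (U \<times> U)) \<le> n\<^sup>2" for f :: "'a \<times> 'a \<Rightarrow> 'a \<times> 'a \<times> 'a"
    using card_image_le[of "U \<times> U" f] finite_U
    by (simp add: n_def power2_eq_square card_cartesian_product)
  have "card bad \<le> n\<^sup>2 + n\<^sup>2 + n\<^sup>2 + n\<^sup>2 + n\<^sup>2 + n\<^sup>2"
    unfolding bad_def by (intro order.trans[OF card_Un_le] add_mono img)
  then have "card bad \<le> 6 * n\<^sup>2" by simp
  then have bad: "real (card bad) \<le> 6 * real n ^ 2"
    by (metis of_nat_le_iff of_nat_mult of_nat_numeral of_nat_power)
  have "Z \<subseteq> four_cycles U D u \<union> bad"
  proof (rule subsetI, clarify)
    fix a b c assume "(a, b, c) \<in> Z" "(a, b, c) \<notin> bad"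
    then show "(a, b, c) \<in> four_cycles U D u"
      by (auto simp: four_cycles_def Z_def A_def C_def bad_def image_iff)
  qed
  moreover have "finite (four_cycles U D u)" "finite bad"
    using \<open>four_cycles U D u \<subseteq> Z\<close> finZ finite_U by (auto intro: finite_subset simp: bad_def)
  ultimately have "card Z \<le> card (four_cycles U D u) + card bad"
    by (meson card_Un_le card_mono finite_UnI order.trans)
  then have *: "real (card Z) - 6 * real n ^ 2 \<le> card (four_cycles U D u)" using bad by linarith
  have "(1 - 2 * \<epsilon>) * (d - \<epsilon>) ^ 4 * real n ^ 3 =
      (1 - 2 * \<epsilon>) * (d - \<epsilon>)\<^sup>2 * (((d - \<epsilon>) * n) * ((d - \<epsilon>) * n) * n)"
    by (simp add: power2_eq_square power3_eq_cube power4_eq_xxxx)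
  also have "\<dots> \<le> (1 - 2 * \<epsilon>) * (d - \<epsilon>)\<^sup>2 * (card A * card C * n)"
    unfolding of_nat_mult using cA cC eps_pos two_eps_less d_le_1
    by (intro mult_left_mono mult_right_mono mult_mono) auto
  also have "\<dots> \<le> card Z" using Z by simp
  finally show ?thesis using * upper by (simp add: n_def)
qed

text \<open>The inner pair is an arc from the out-neighbourhood of \<open>c\<close> to the
  in-neighbourhood of \<open>u\<close>, so a single application of regularity counts such
  pairs.\<close>

lemma card_three_paths:
  assumes u: "u \<in> U" and c: "c \<in> U" and "c \<noteq> u"
  shows "real (card (three_paths U D c u)) \<in>
    {(d - \<epsilon>) ^ 3 * real (card U) ^ 2 - 5 * real (card U) .. (d + \<epsilon>) ^ 3 * real (card U) ^ 2}"
proof -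
  define n where "n = card U"
  define B where "B = {y\<in>U. D c y}"
  define A where "A = {x\<in>U. D x u}"
  define Z where "Z = {(b, a) \<in> B \<times> A. D b a}"
  have B: "B \<subseteq> U" "\<epsilon> * card U < card B"
      and A: "A \<subseteq> U" "\<epsilon> * card U < card A"
    using out_degree_large[OF c] in_degree_large[OF u] by (auto simp: A_def B_def)
  have cB: "(d - \<epsilon>) * n \<le> card B" "card B \<le> (d + \<epsilon>) * n"
    and cA: "(d - \<epsilon>) * n \<le> card A" "card A \<le> (d + \<epsilon>) * n"
    using out_degree[OF c] in_degree[OF u] by (auto simp: A_def B_def n_def)
  note Z = regular[OF B(1) A(1) B(2) A(2), folded Z_def n_def]
  have fin: "finite A" "finite B" using A B finite_U finite_subset by auto
  have finZ: "finite Z" unfolding Z_def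
    by (rule finite_subset[of _ "B \<times> A"]) (use fin in auto)
  \<comment> \<open>\<open>Z\<close> lists the pair in the direction of the path,
    \<open>three_paths\<close> in the opposite one.\<close>
  have sub: "prod.swap ` three_paths U D c u \<subseteq> Z" by (auto simp: three_paths_def Z_def A_def B_def)
  have card_swap: "card (prod.swap ` three_paths U D c u) = card (three_paths U D c u)"
    by (simp add: card_image)
  have "real (card (three_paths U D c u)) \<le> card Z"
    using card_mono[OF finZ sub] by (simp add: card_swap)
  also have "\<dots> \<le> (d + \<epsilon>) * (card B * card A)" using Z by simp
  also have "\<dots> \<le> (d + \<epsilon>) * (((d + \<epsilon>) * n) * ((d + \<epsilon>) * n))"
    unfolding of_nat_mult using cA cB eps_pos two_eps_less by (intro mult_left_mono mult_mono) auto
  also have "\<dots> = (d + \<epsilon>) ^ 3 * real n ^ 2"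
    by (simp add: power2_eq_square power3_eq_cube)
  finally have upper: "real (card (three_paths U D c u)) \<le> \<dots>" .
  \<comment> \<open>Five coincidences remain, since \<open>c\<close> and \<open>u\<close> are
    distinct.\<close>
  define bad where "bad = (\<lambda>x. (u, x)) ` U \<union> (\<lambda>x. (x, u)) ` U \<union>
    (\<lambda>x. (c, x)) ` U \<union> (\<lambda>x. (x, c)) ` U \<union> (\<lambda>x. (x, x)) ` U"
  have img: "card (f ` U) \<le> n" for f :: "'a \<Rightarrow> 'a \<times> 'a"
    using card_image_le[of U f] finite_U by (simp add: n_def)
  have "card bad \<le> n + n + n + n + n"
    unfolding bad_def by (intro order.trans[OF card_Un_le] add_mono img)
  then have bad: "real (card bad) \<le> 5 * real n" by linarith
  have "Z \<subseteq> prod.swap ` three_paths U D c u \<union> bad"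
  proof (rule subsetI, clarify)
    fix b a assume *: "(b, a) \<in> Z" "(b, a) \<notin> bad"
    then have "(a, b) \<in> three_paths U D c u"
      using \<open>c \<noteq> u\<close> by (auto simp: three_paths_def Z_def A_def B_def bad_def image_iff)
    then show "(b, a) \<in> prod.swap ` three_paths U D c u" by (force simp: image_iff)
  qed
  moreover have "finite (prod.swap ` three_paths U D c u)" "finite bad"
    using sub finZ finite_U finite_subset by (auto simp: bad_def)
  ultimately have "card Z \<le> card (three_paths U D c u) + card bad"
    by (metis card_Un_le card_mono card_swap finite_UnI order.trans)
  then have *: "real (card Z) - 5 * n \<le> card (three_paths U D c u)" using bad by linarith
  have "(d - \<epsilon>) ^ 3 * real n ^ 2 = (d - \<epsilon>) * (((d - \<epsilon>) * n) * ((d - \<epsilon>) * n))"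
    by (simp add: power2_eq_square power3_eq_cube)
  also have "\<dots> \<le> (d - \<epsilon>) * (card B * card A)"
    unfolding of_nat_mult using cA cB eps_pos two_eps_less
    by (intro mult_left_mono mult_mono) auto
  also have "\<dots> \<le> card Z" using Z by simp
  finally show ?thesis using * upper by (simp add: n_def)
qed

text \<open>Positive density between the two neighbourhoods of \<open>u\<close> provides the middle
  arc. The vertices of the walk may coincide. It serves to improve a bijection that is not yet a
  matching.\<close>

lemma exists_three_walk:
  assumes u: "u \<in> U"
  shows "\<exists>a\<in>U. \<exists>c\<in>U. D u a \<and> D a c \<and> D c u"
proof -
  let ?A = "{y\<in>U. D u y}" and ?C = "{x\<in>U. D x u}"
  have large: "\<epsilon> * card U < card ?A" "\<epsilon> * card U < card ?C"
    using out_degree_large[OF u] in_degree_large[OF u] .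
  have "0 < \<epsilon> * card U" using eps_pos card_U_pos by simp
  then have "0 < real (card ?A)" "0 < real (card ?C)" using large by linarith+
  then have "0 < (d - \<epsilon>) * (card ?A * card ?C)" using eps_pos two_eps_less by simp
  also have "\<dots> \<le> card {(x, y) \<in> ?A \<times> ?C. D x y}" using regular[of ?A ?C] large by simp
  finally have "{(x, y) \<in> ?A \<times> ?C. D x y} \<noteq> {}"
    by (metis (no_types, lifting) card.empty less_irrefl of_nat_0)
  then show ?thesis by blast
qed

end

section \<open>Bijections, their digraphs and perfect matchings\<close>

text \<open>Relabelling \<open>W\<close> through \<open>\<sigma>\<close> makes the edges at
  \<open>\<sigma> y\<close> the arcs into \<open>y\<close>, which preserves degrees and densities.
  \<open>\<sigma>\<close> may be any bijection, because the existence of a perfect matching is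
  proved by improving one that need not follow edges.\<close>

lemma super_regular_digraph_bijection:
  assumes sr: "super_regular_pair \<epsilon> d U W E" and card: "card U = card W" and "U \<noteq> {}"
    and \<epsilon>: "0 < \<epsilon>" "2 * \<epsilon> < d" "d \<le> 1" and \<sigma>: "bij_betw \<sigma> U W"
  shows "super_regular_digraph U (\<lambda>x y. (x, \<sigma> y) \<in> E) \<epsilon> d"
proof
  have reg: "regular_pair \<epsilon> d U W E" using sr by (simp add: super_regular_pair_def)
  have fin: "finite U" "finite W" and E: "E \<subseteq> U \<times> W"
    using reg by (auto simp: regular_pair_def bipartite_graph_def)
  have inj: "inj_on \<sigma> U" and img: "\<sigma> ` U = W" using \<sigma> by (auto simp: bij_betw_def)
  show "finite U" by fact
  show "real (card {y\<in>U. (x, \<sigma> y) \<in> E}) \<in> {(d - \<epsilon>) * card U .. (d + \<epsilon>) * card U}" if "x \<in> U" for x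
  proof -
    have "\<sigma> ` {y\<in>U. (x, \<sigma> y) \<in> E} = {w. (x, w) \<in> E}" using E img by blast
    moreover have "inj_on \<sigma> {y\<in>U. (x, \<sigma> y) \<in> E}" by (rule inj_on_subset[OF inj]) auto
    ultimately have "card {y\<in>U. (x, \<sigma> y) \<in> E} = card {w. (x, w) \<in> E}" by (metis card_image)
    then show ?thesis using sr that card by (simp add: super_regular_pair_def)
  qed
  show "real (card {x\<in>U. (x, \<sigma> y) \<in> E}) \<in> {(d - \<epsilon>) * card U .. (d + \<epsilon>) * card U}" if "y \<in> U" for y
  proof -
    have "{x\<in>U. (x, \<sigma> y) \<in> E} = {x. (x, \<sigma> y) \<in> E}" using E by blast
    moreover have "\<sigma> y \<in> W" using img that by blast
    ultimately show ?thesis using sr by (simp add: super_regular_pair_def)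
  qed
  fix X Y assume XY: "X \<subseteq> U" "Y \<subseteq> U" "\<epsilon> * card U < card X" "\<epsilon> * card U < card Y"
  have injY: "inj_on \<sigma> Y" using inj XY(2) by (rule inj_on_subset)
  have im: "map_prod id \<sigma> ` {(x, y) \<in> X \<times> Y. (x, \<sigma> y) \<in> E} = edges_between E X (\<sigma> ` Y)"
    by (force simp: edges_between_def image_iff)
  have "inj_on (map_prod id \<sigma>) {(x, y) \<in> X \<times> Y. (x, \<sigma> y) \<in> E}"
    using injY by (auto simp: inj_on_def)
  from card_image[OF this, unfolded im]
  have e: "card {(x, y) \<in> X \<times> Y. (x, \<sigma> y) \<in> E} = card (edges_between E X (\<sigma> ` Y))"
    by (rule sym)
  have cY: "card (\<sigma> ` Y) = card Y" using injY by (rule card_image)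
  have "\<sigma> ` Y \<subseteq> W" using XY img by blast
  then have "eq_up_to (card (edges_between E X (\<sigma> ` Y)) / (real (card X) * card Y)) d \<epsilon>"
    using reg[unfolded regular_pair_def, THEN conjunct2, rule_format, of X "\<sigma> ` Y"] XY card cY by simp
  moreover have "0 < real (card X) * card Y"
  proof -
    have "0 \<le> \<epsilon> * card U" using \<epsilon> by simp
    then have "0 < real (card X)" "0 < real (card Y)" using XY by linarith+
    then show ?thesis by simp
  qed
  ultimately show "real (card {(x, y) \<in> X \<times> Y. (x, \<sigma> y) \<in> E}) \<in>
        {(d - \<epsilon>) * (card X * card Y) .. (d + \<epsilon>) * (card X * card Y)}"
    unfolding e by (simp add: eq_up_to_def pos_le_divide_eq pos_divide_le_eq)
qed (rule \<epsilon> \<open>U \<noteq> {}\<close>)+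

text \<open>Fixing the values outside \<open>U\<close> gives each matching exactly one function, so
  that cardinalities agree.\<close>

definition matching_bijections :: "'a set \<Rightarrow> 'b set \<Rightarrow> ('a \<times> 'b) set \<Rightarrow> ('a \<Rightarrow> 'b) set" where
  "matching_bijections U W E =
     {\<sigma> \<in> extensional U. bij_betw \<sigma> U W \<and> (\<forall>x\<in>U. (x, \<sigma> x) \<in> E)}"

lemma finite_matching_bijections:
  assumes "finite U" "finite W"
  shows "finite (matching_bijections U W E)"
proof (rule finite_subset)
  show "matching_bijections U W E \<subseteq> U \<rightarrow>\<^sub>E W"
    by (auto simp: matching_bijections_def PiE_def bij_betw_def)
  show "finite (U \<rightarrow>\<^sub>E W)" using assms by (rule finite_PiE)
qed

text \<open>The inverse sends a bijection to its graph. Counting can thus take place among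
  functions, where switching is composition with a permutation.\<close>

lemma bij_betw_perfect_matchings:
  assumes G: "bipartite_graph U W E"
  shows "bij_betw (\<lambda>M. restrict (matching_fun M) U) (perfect_matchings U W E) (matching_bijections U W E)"
proof (rule bij_betw_byWitness[where f' = "\<lambda>\<sigma>. (\<lambda>x. (x, \<sigma> x)) ` U"])
  note mf = matching_fun_bij_betw[OF G]
  have sub: "M \<subseteq> U \<times> W" if "M \<in> perfect_matchings U W E" for M
    using G that by (auto simp: bipartite_graph_def perfect_matchings_def)
  show "\<forall>M\<in>perfect_matchings U W E. (\<lambda>x. (x, restrict (matching_fun M) U x)) ` U = M"
  proof
    fix M assume M: "M \<in> perfect_matchings U W E"
    show "(\<lambda>x. (x, restrict (matching_fun M) U x)) ` U = M"
    proof (rule set_eqI, clarify)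
      fix x y
      show "(x, y) \<in> (\<lambda>x. (x, restrict (matching_fun M) U x)) ` U \<longleftrightarrow> (x, y) \<in> M"
        using mf(2)[OF M, of x y] sub[OF M] by (auto simp: image_iff)
    qed
  qed
  have graph: "(\<lambda>x. (x, \<sigma> x)) ` U \<in> perfect_matchings U W E"
    if "\<sigma> \<in> matching_bijections U W E" for \<sigma>
  proof -
    have s: "inj_on \<sigma> U" "\<sigma> ` U = W" "\<forall>x\<in>U. (x, \<sigma> x) \<in> E"
      using that by (auto simp: matching_bijections_def bij_betw_def)
    have "\<exists>!e. e \<in> (\<lambda>x. (x, \<sigma> x)) ` U \<and> snd e = w" if w: "w \<in> W" for w
    proof -
      obtain x where "x \<in> U" "\<sigma> x = w" using s w by blast
      then show ?thesis using s(1) by (intro ex1I[of _ "(x, w)"]) (auto simp: inj_on_def)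
    qed
    then show ?thesis using s(3) by (auto simp: perfect_matchings_def)
  qed
  then show "(\<lambda>\<sigma>. (\<lambda>x. (x, \<sigma> x)) ` U) ` matching_bijections U W E \<subseteq> perfect_matchings U W E"
    by blast
  show "\<forall>\<sigma>\<in>matching_bijections U W E. restrict (matching_fun ((\<lambda>x. (x, \<sigma> x)) ` U)) U = \<sigma>"
  proof
    fix \<sigma> assume \<sigma>: "\<sigma> \<in> matching_bijections U W E"
    show "restrict (matching_fun ((\<lambda>x. (x, \<sigma> x)) ` U)) U = \<sigma>"
    proof (rule extensionalityI[of _ U])
      show "\<sigma> \<in> extensional U" using \<sigma> by (simp add: matching_bijections_def)
      show "restrict (matching_fun ((\<lambda>x. (x, \<sigma> x)) ` U)) U x = \<sigma> x" if "x \<in> U" for x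
        using mf(2)[OF graph[OF \<sigma>] that, of "\<sigma> x"] that by auto
    qed simp
  qed
  show "(\<lambda>M. restrict (matching_fun M) U) ` perfect_matchings U W E \<subseteq> matching_bijections U W E"
  proof clarify
    fix M assume M: "M \<in> perfect_matchings U W E"
    have "(x, matching_fun M x) \<in> E" if "x \<in> U" for x
      using mf(2)[OF M that] M by (auto simp: perfect_matchings_def)
    then show "restrict (matching_fun M) U \<in> matching_bijections U W E"
      using mf(1)[OF M] by (simp add: matching_bijections_def bij_betw_restrict_eq)
  qed
qed

lemma matching_bijections_comp:
  assumes \<sigma>: "\<sigma> \<in> extensional U" "bij_betw \<sigma> U W" and p: "p permutes U"
    and E: "\<And>x. x \<in> U \<Longrightarrow> (x, \<sigma> (p x)) \<in> E"
  shows "\<sigma> \<circ> p \<in> matching_bijections U W E"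
proof -
  have "bij_betw (\<sigma> \<circ> p) U W" using permutes_imp_bij[OF p] \<sigma>(2) by (rule bij_betw_trans)
  moreover have "\<sigma> \<circ> p \<in> extensional U"
    using \<sigma>(1) p by (auto simp: extensional_def permutes_def)
  ultimately show ?thesis using E by (simp add: matching_bijections_def)
qed

text \<open>A bijection that uses the largest possible number of edges is a perfect matching: at a vertex
  \<open>u\<close> that is not matched along an edge, a closed walk of length three in the switching
  digraph would yield a better one.\<close>

lemma matching_bijections_nonempty:
  assumes sr: "super_regular_pair \<epsilon> d U W E" and card: "card U = card W" and ne: "U \<noteq> {}"
    and \<epsilon>: "0 < \<epsilon>" "2 * \<epsilon> < d" "d \<le> 1"
  shows "matching_bijections U W E \<noteq> {}"
proof -
  have fin: "finite U" "finite W"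
    using sr by (auto simp: super_regular_pair_def regular_pair_def bipartite_graph_def)
  define good where "good \<sigma> = {x\<in>U. (x, \<sigma> x) \<in> E}" for \<sigma> :: "'a \<Rightarrow> 'b"
  have "\<exists>\<sigma>. bij_betw \<sigma> U W" using fin card by (intro finite_same_card_bij)
  moreover have "\<forall>\<sigma>. bij_betw \<sigma> U W \<longrightarrow> card (good \<sigma>) < Suc (card U)"
    using fin by (auto simp: good_def less_Suc_eq_le intro!: card_mono)
  ultimately obtain \<sigma> where \<sigma>: "bij_betw \<sigma> U W"
    and max: "\<And>\<tau>. bij_betw \<tau> U W \<Longrightarrow> card (good \<tau>) \<le> card (good \<sigma>)"
    using ex_has_greatest_nat[of "\<lambda>\<sigma>. bij_betw \<sigma> U W" _ "\<lambda>\<sigma>. card (good \<sigma>)"] by blast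
  interpret super_regular_digraph U "\<lambda>x y. (x, \<sigma> y) \<in> E" \<epsilon> d
    using assms \<sigma> by (intro super_regular_digraph_bijection)
  have "(u, \<sigma> u) \<in> E" if u: "u \<in> U" for u
  proof (rule ccontr)
    assume bad: "(u, \<sigma> u) \<notin> E"
    obtain a c where ac: "a \<in> U" "c \<in> U" "(u, \<sigma> a) \<in> E" "(a, \<sigma> c) \<in> E" "(c, \<sigma> u) \<in> E"
      using exists_three_walk[OF u] by blast
    \<comment> \<open>If \<open>a\<close> or \<open>c\<close> were \<open>u\<close>, an arc of the
      walk would be the loop at \<open>u\<close>, which is excluded. The case \<open>a = c\<close>
      is possible; \<open>p\<close> is then the transposition of \<open>u\<close> and
      \<open>a\<close>.\<close>
    have neq: "a \<noteq> u" "c \<noteq> u" using bad ac by auto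
    define p where "p = Transposition.transpose u a \<circ> Transposition.transpose a c"
    have p: "p permutes U"
      unfolding p_def using ac u by (intro permutes_compose permutes_swap_id)
    then have "bij_betw (\<sigma> \<circ> p) U W"
      using permutes_imp_bij \<sigma> by (blast intro: bij_betw_trans)
    then have "card (good (\<sigma> \<circ> p)) \<le> card (good \<sigma>)" by (rule max)
    \<comment> \<open>Under \<open>p\<close> the vertices \<open>u\<close>, \<open>a\<close>,
      \<open>c\<close> all use edges from the walk and every other vertex keeps its image, so
      \<open>u\<close> is gained and nothing is lost.\<close>
    moreover have "insert u (good \<sigma>) \<subseteq> good (\<sigma> \<circ> p)"
    proof
      fix x assume x: "x \<in> insert u (good \<sigma>)"
      then have "(x, \<sigma> (p x)) \<in> E"
        using ac neq by (auto simp: p_def good_def Transposition.transpose_def)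
      then show "x \<in> good (\<sigma> \<circ> p)" using x u by (auto simp: good_def)
    qed
    then have "card (insert u (good \<sigma>)) \<le> card (good (\<sigma> \<circ> p))"
      using fin by (intro card_mono) (auto simp: good_def)
    moreover have "card (insert u (good \<sigma>)) = Suc (card (good \<sigma>))"
      using fin bad by (subst card_insert_disjoint) (auto simp: good_def)
    ultimately show False by linarith
  qed
  then have "restrict \<sigma> U \<in> matching_bijections U W E"
    using \<sigma> by (simp add: matching_bijections_def bij_betw_restrict_eq)
  then show ?thesis by blast
qed

section \<open>Switching along four-cycles\<close>

text \<open>As a product of transpositions this is a permutation for all arguments, and listing the
  arguments backwards inverts it by cancellation from the middle.\<close>

definition four_cycle :: "'a \<Rightarrow> 'a \<Rightarrow> 'a \<Rightarrow> 'a \<Rightarrow> 'a \<Rightarrow> 'a" where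
  "four_cycle u a b c =
     Transposition.transpose u a \<circ> Transposition.transpose a b \<circ> Transposition.transpose b c"

lemma four_cycle_apply:
  assumes "distinct [u, a, b, c]"
  shows "four_cycle u a b c u = a" "four_cycle u a b c a = b"
    "four_cycle u a b c b = c" "four_cycle u a b c c = u"
    "x \<notin> {u, a, b, c} \<Longrightarrow> four_cycle u a b c x = x"
  using assms by (auto simp: four_cycle_def Transposition.transpose_def)

lemma four_cycle_permutes:
  "{u, a, b, c} \<subseteq> U \<Longrightarrow> four_cycle u a b c permutes U"
  unfolding four_cycle_def by (intro permutes_compose permutes_swap_id) auto

lemma four_cycle_inverse: "four_cycle u a b c \<circ> four_cycle c b a u = id"
  by (simp add: four_cycle_def fun_eq_iff transpose_commute)

text \<open>Both sides count the switchings between matchings with and without \<open>uv\<close>: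
  once from the matching before the switch, once from the one after it.\<close>

lemma sum_four_cycles_eq_sum_three_paths:
  fixes E :: "('a \<times> 'b) set"
  assumes fin: "finite U" "finite W" and uv: "(u, v) \<in> E" and u: "u \<in> U" and v: "v \<in> W"
  shows "(\<Sum>\<sigma> | \<sigma> \<in> matching_bijections U W E \<and> \<sigma> u = v.
      card (four_cycles U (\<lambda>x y. (x, \<sigma> y) \<in> E) u)) =
    (\<Sum>\<sigma> | \<sigma> \<in> matching_bijections U W E \<and> \<sigma> u \<noteq> v.
      card (three_paths U (\<lambda>x y. (x, \<sigma> y) \<in> E) (inv_into U \<sigma> v) u))"
proof -
  define F where "F = matching_bijections U W E"
  let ?D = "\<lambda>(\<sigma> :: 'a \<Rightarrow> 'b) x y. (x, \<sigma> y) \<in> E"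
  define P where "P = (SIGMA \<sigma>:{\<sigma>\<in>F. \<sigma> u = v}. four_cycles U (?D \<sigma>) u)"
  define Q where "Q = (SIGMA \<sigma>:{\<sigma>\<in>F. \<sigma> u \<noteq> v}. three_paths U (?D \<sigma>) (inv_into U \<sigma> v) u)"
  \<comment> \<open>\<open>\<Phi>\<close> may forget \<open>c\<close>, because \<open>\<Psi>\<close>
    recovers it as the vertex that the new matching sends to \<open>v\<close>.\<close>
  define \<Phi> where "\<Phi> = (\<lambda>(\<sigma> :: 'a \<Rightarrow> 'b, a, b, c). (\<sigma> \<circ> four_cycle u a b c, a, b))"
  define \<Psi> where "\<Psi> = (\<lambda>(\<sigma> :: 'a \<Rightarrow> 'b, a, b). let c = inv_into U \<sigma> v in
    (\<sigma> \<circ> four_cycle c b a u, a, b, c))"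
  have finF: "finite F" unfolding F_def using fin by (rule finite_matching_bijections)
  have finfc: "finite (four_cycles U (?D \<sigma>) u)" for \<sigma>
    by (rule finite_subset[of _ "U \<times> U \<times> U"]) (use fin in \<open>auto simp: four_cycles_def\<close>)
  have fintp: "finite (three_paths U (?D \<sigma>) c u)" for \<sigma> c
    by (rule finite_subset[of _ "U \<times> U"]) (use fin in \<open>auto simp: three_paths_def\<close>)
  have F: "\<sigma> \<in> extensional U" "bij_betw \<sigma> U W" "inj_on \<sigma> U" "\<And>x. x \<in> U \<Longrightarrow> (x, \<sigma> x) \<in> E" if "\<sigma> \<in> F" for \<sigma>
    using that by (auto simp: F_def matching_bijections_def bij_betw_def)
  have fwd: "\<Phi> z \<in> Q \<and> \<Psi> (\<Phi> z) = z" if "z \<in> P" for z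
  proof -
    obtain \<sigma> a b c where z: "z = (\<sigma>, a, b, c)" by (metis prod_cases4)
    have \<sigma>: "\<sigma> \<in> F" "\<sigma> u = v" and U: "a \<in> U" "b \<in> U" "c \<in> U" and dist: "distinct [u, a, b, c]"
      and ed: "(u, \<sigma> a) \<in> E" "(a, \<sigma> b) \<in> E" "(b, \<sigma> c) \<in> E" "(c, \<sigma> u) \<in> E"
      using that by (auto simp: z P_def four_cycles_def)
    note ap = four_cycle_apply[OF dist]
    define \<tau> where "\<tau> = \<sigma> \<circ> four_cycle u a b c"
    have \<tau>: "\<tau> \<in> F" unfolding \<tau>_def F_def
    proof (rule matching_bijections_comp[OF F(1,2)[OF \<sigma>(1)]])
      show "four_cycle u a b c permutes U" using u U by (intro four_cycle_permutes) auto
      \<comment> \<open>On the cycle the new edges are its arcs; elsewhere nothing changes.\<close>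
      show "(x, \<sigma> (four_cycle u a b c x)) \<in> E" if "x \<in> U" for x
        using ap ed F(4)[OF \<sigma>(1) that] by (cases "x \<in> {u, a, b, c}") auto
    qed
    have \<tau>_apply: "\<tau> u = \<sigma> a" "\<tau> a = \<sigma> b" "\<tau> b = \<sigma> c" "\<tau> c = v"
      using ap \<sigma>(2) by (auto simp: \<tau>_def)
    have "\<tau> u \<noteq> v"
      using \<tau>_apply(1) inj_on_eq_iff[OF F(3)[OF \<sigma>(1)] U(1) u] \<sigma>(2) dist by auto
    moreover have inv: "inv_into U \<tau> v = c"
      using \<tau>_apply(4) F(3)[OF \<tau>] U by (metis inv_into_f_f)
    \<comment> \<open>The arcs of the reverse path are the old matching edges at \<open>c\<close>,
      \<open>b\<close> and \<open>a\<close>.\<close>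
    moreover have "(a, b) \<in> three_paths U (?D \<tau>) c u"
      using U dist F(4)[OF \<sigma>(1)] by (auto simp: three_paths_def \<tau>_apply)
    ultimately have "\<Phi> z \<in> Q" using \<tau> by (simp add: z \<Phi>_def Q_def \<tau>_def)
    moreover have "\<Psi> (\<Phi> z) = z"
      using inv by (simp add: z \<Phi>_def \<Psi>_def \<tau>_def Let_def comp_assoc four_cycle_inverse)
    ultimately show ?thesis ..
  qed
  have bwd: "\<Psi> z \<in> P \<and> \<Phi> (\<Psi> z) = z" if "z \<in> Q" for z
  proof -
    obtain \<tau> a b where z: "z = (\<tau>, a, b)" by (metis prod_cases3)
    define c where "c = inv_into U \<tau> v"
    have \<tau>: "\<tau> \<in> F" "\<tau> u \<noteq> v" and ab: "a \<in> U" "b \<in> U" and dist: "distinct [u, a, b, c]"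
      and ed: "(c, \<tau> b) \<in> E" "(b, \<tau> a) \<in> E" "(a, \<tau> u) \<in> E"
      using that by (auto simp: z Q_def three_paths_def c_def)
    have "v \<in> \<tau> ` U" using F(2)[OF \<tau>(1)] v by (simp add: bij_betw_def)
    then have c: "c \<in> U" "\<tau> c = v" unfolding c_def by (rule inv_into_into, rule f_inv_into_f)
    have dist': "distinct [c, b, a, u]" using dist by auto
    note ap = four_cycle_apply[OF dist']
    define \<sigma> where "\<sigma> = \<tau> \<circ> four_cycle c b a u"
    have \<sigma>: "\<sigma> \<in> F" unfolding \<sigma>_def F_def
    proof (rule matching_bijections_comp[OF F(1,2)[OF \<tau>(1)]])
      show "four_cycle c b a u permutes U" using u ab c by (intro four_cycle_permutes) auto
      \<comment> \<open>Here \<open>(u, v) \<in> E\<close> enters: the path supplies the new edges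
        at \<open>c\<close>, \<open>b\<close> and \<open>a\<close>, while \<open>u\<close> receives
        \<open>v\<close>.\<close>
      show "(x, \<tau> (four_cycle c b a u x)) \<in> E" if "x \<in> U" for x
        using ap ed c uv F(4)[OF \<tau>(1) that] by (cases "x \<in> {u, a, b, c}") auto
    qed
    have \<sigma>_apply: "\<sigma> u = v" "\<sigma> a = \<tau> u" "\<sigma> b = \<tau> a" "\<sigma> c = \<tau> b"
      using ap c by (auto simp: \<sigma>_def)
    have "(a, b, c) \<in> four_cycles U (?D \<sigma>) u"
      using ab c u dist F(4)[OF \<tau>(1)] F(4)[OF \<tau>(1) c(1)] by (auto simp: four_cycles_def \<sigma>_apply)
    then have "\<Psi> z \<in> P" using \<sigma> \<sigma>_apply(1) by (simp add: z \<Psi>_def P_def \<sigma>_def c_def Let_def)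
    moreover have "\<Phi> (\<Psi> z) = z"
      by (simp add: z \<Phi>_def \<Psi>_def Let_def comp_assoc four_cycle_inverse)
    ultimately show ?thesis ..
  qed
  have "bij_betw \<Phi> P Q"
    by (rule bij_betw_byWitness[where f' = \<Psi>]) (use fwd bwd in auto)
  then have "card P = card Q" by (rule bij_betw_same_card)
  then show ?thesis using finF finfc fintp by (simp add: P_def Q_def F_def)
qed

section \<open>Numerical estimates\<close>

text \<open>Writing \<open>\<epsilon>\<close> as
  \<open>\<epsilon> powr (19/20) * \<epsilon> powr (1/20)\<close> leaves
  \<open>40 * \<epsilon> powr (19/20) \<le> d ^ 4\<close> to show. As 19/20 exceeds 4/5, the fifth
  power in the hypothesis gives this with the larger factor \<open>40 ^ 4 = 2560000\<close>.\<close>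

lemma eps_powr_bound:
  fixes \<epsilon> d :: real
  assumes "0 < \<epsilon>" "\<epsilon> \<le> (d / 40) ^ 5" "0 < d" "d \<le> 1"
  shows "40 * (\<epsilon> / d ^ 4) \<le> \<epsilon> powr (1/20)"
proof -
  have "(d / 40) ^ 5 \<le> 1" using assms by (intro power_le_one) auto
  then have "\<epsilon> \<le> 1" using assms by linarith
  have "\<epsilon> powr (19/20) \<le> \<epsilon> powr (4/5)"
    using assms(1) \<open>\<epsilon> \<le> 1\<close> by (intro powr_mono') auto
  also have "\<dots> \<le> ((d / 40) ^ 5) powr (4/5)"
    using assms by (intro powr_mono2) auto
  also have "\<dots> = (d / 40) ^ 4"
  proof -
    have "(d / 40) ^ 5 = (d / 40) powr 5" "(d / 40) ^ 4 = (d / 40) powr 4"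
      using assms powr_realpow[of "d / 40" 5] powr_realpow[of "d / 40" 4] by auto
    then show ?thesis by (simp only: powr_powr) simp
  qed
  finally have "2560000 * \<epsilon> powr (19/20) \<le> d ^ 4"
    by (simp add: power_divide)
  then have "40 * \<epsilon> powr (19/20) \<le> d ^ 4"
    using powr_ge_zero[of \<epsilon> "19/20"] by linarith
  then have "40 * \<epsilon> powr (19/20) * \<epsilon> powr (1/20) \<le> d ^ 4 * \<epsilon> powr (1/20)"
    by (intro mult_right_mono) auto
  moreover have "\<epsilon> powr (19/20) * \<epsilon> powr (1/20) = \<epsilon>"
    using assms by (simp flip: powr_add)
  ultimately have "40 * \<epsilon> \<le> d ^ 4 * \<epsilon> powr (1/20)" by (simp only: mult.assoc)
  then show ?thesis using assms(3) by (simp add: pos_divide_le_eq mult.commute)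
qed

text \<open>The case \<open>T = d\<^sup>4 n\<^sup>3\<close>, \<open>S = d\<^sup>3 n\<^sup>2\<close> of exact counts gives \<open>k / (m - k) = 1 / (d n)\<close>; here
  \<open>\<theta> = \<epsilon> / d\<^sup>4\<close> measures the relative error.\<close>

lemma edge_ratio_bounds:
  fixes \<epsilon> d n k m :: real
  assumes \<epsilon>: "0 < \<epsilon>" and d: "0 < d" "d \<le> 1" and n: "0 < n" "1 / n \<le> \<epsilon>"
    and \<theta>_small: "\<epsilon> / d ^ 4 \<le> 1/100"
    and k: "0 \<le> k" "k \<le> m" and m: "0 < m"
    and up: "k * ((1 - 2 * \<epsilon>) * (d - \<epsilon>) ^ 4 * n ^ 3 - 6 * n ^ 2) \<le> (m - k) * ((d + \<epsilon>) ^ 3 * n ^ 2)"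
    and lo: "(m - k) * ((d - \<epsilon>) ^ 3 * n ^ 2 - 5 * n) \<le> k * (((d + \<epsilon>)\<^sup>2 + 2 * \<epsilon>) * (d + \<epsilon>)\<^sup>2 * n ^ 3)"
    and \<delta>: "40 * (\<epsilon> / d ^ 4) \<le> \<delta>"
  shows "k / m \<in> {(1 - \<delta>) * (1 / (d * n)) .. (1 + \<delta>) * (1 / (d * n))}"
proof -
  define \<theta> where "\<theta> = \<epsilon> / d ^ 4"
  have \<theta>: "0 < \<theta>" "\<theta> \<le> 1/100" using \<epsilon> d \<theta>_small by (auto simp: \<theta>_def)
  have eps: "\<epsilon> = \<theta> * d ^ 4" using d by (simp add: \<theta>_def)
  have dpow: "d ^ 4 \<le> d ^ j" if "j \<le> 4" for j using d that by (intro power_decreasing) auto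
  \<comment> \<open>Since \<open>d \<le> 1\<close>, the one relative error \<open>\<theta>\<close>
    controls \<open>\<epsilon>\<close> against each power of \<open>d\<close> that occurs.\<close>
  have eps_le: "\<epsilon> \<le> \<theta> * d ^ j" if "j \<le> 4" for j
    unfolding eps using dpow[OF that] \<theta> by (intro mult_left_mono) auto
  have e1: "\<epsilon> \<le> \<theta> * d" using eps_le[of 1] by simp
  have e0: "\<epsilon> \<le> \<theta>" using eps_le[of 0] by simp
  \<comment> \<open>This absorbs the degenerate configurations: each factor \<open>1 / n\<close>
    costs at most \<open>\<epsilon>\<close>.\<close>
  have n1: "1 \<le> n * \<epsilon>" using n by (simp add: field_simps)
  have dp: "d + \<epsilon> \<le> d * (1 + \<theta>)" and dm: "d * (1 - \<theta>) \<le> d - \<epsilon>"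
    using e1 by (auto simp: algebra_simps)
  \<comment> \<open>Quadratic errors become linear ones, so all later estimates are linear in
    \<open>\<theta>\<close>.\<close>
  have sq: "\<theta> * \<theta> \<le> \<theta> / 100" "0 \<le> \<theta> * \<theta>" using mult_left_mono[OF \<theta>(2), of \<theta>] \<theta> by auto
  have dm0: "0 \<le> d * (1 - \<theta>)" using d \<theta> by simp
  have bern: "1 - real j * \<theta> \<le> (1 - \<theta>) ^ j" for j
    using Bernoulli_inequality[of "- \<theta>" j] \<theta> by simp
  have p2: "(1 + \<theta>) ^ 2 \<le> 1 + 201/100 * \<theta>"
    using sq by (simp add: power2_eq_square algebra_simps)
  have p3: "(1 + \<theta>) ^ 3 \<le> 1 + 7 * \<theta>"
  proof -
    have "(1 + \<theta>) ^ 3 = (1 + \<theta>) ^ 2 * (1 + \<theta>)" by (simp add: power2_eq_square power3_eq_cube)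
    also have "\<dots> \<le> (1 + 201/100 * \<theta>) * (1 + \<theta>)" using p2 \<theta> by (intro mult_right_mono) auto
    also have "\<dots> \<le> 1 + 7 * \<theta>" using sq \<theta> by (simp add: algebra_simps)
    finally show ?thesis .
  qed
  have S_hi: "(d + \<epsilon>) ^ 3 * n ^ 2 \<le> (1 + 7 * \<theta>) * (d ^ 3 * n ^ 2)"
  proof -
    have "(d + \<epsilon>) ^ 3 \<le> (d * (1 + \<theta>)) ^ 3" using dp d \<epsilon> by (intro power_mono) auto
    also have "\<dots> \<le> d ^ 3 * (1 + 7 * \<theta>)"
      unfolding power_mult_distrib using p3 d by (intro mult_left_mono) auto
    finally show ?thesis using n mult_right_mono[of _ _ "n\<^sup>2"] by (simp add: mult_ac)
  qed
  \<comment> \<open>8 = 3 + 5: Bernoulli's inequality for the cube, and the five degenerate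
    families.\<close>
  have S_lo: "(1 - 8 * \<theta>) * (d ^ 3 * n ^ 2) \<le> (d - \<epsilon>) ^ 3 * n ^ 2 - 5 * n"
  proof -
    have "(1 - 3 * \<theta>) * d ^ 3 \<le> (1 - \<theta>) ^ 3 * d ^ 3"
      using bern[of 3] d by (intro mult_right_mono) auto
    also have "\<dots> \<le> (d - \<epsilon>) ^ 3"
      using power_mono[OF dm dm0, of 3] by (simp add: power_mult_distrib mult.commute)
    finally have "(1 - 3 * \<theta>) * d ^ 3 * n ^ 2 \<le> (d - \<epsilon>) ^ 3 * n ^ 2" by (rule mult_right_mono) simp
    moreover have "n * 1 \<le> n * (n * (\<theta> * d ^ 3))"
    proof (rule mult_left_mono)
      show "1 \<le> n * (\<theta> * d ^ 3)"
        using n(1) n1 mult_left_mono[OF eps_le[of 3], of n] by linarith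
    qed (use n in simp)
    ultimately show ?thesis by (simp add: power2_eq_square algebra_simps)
  qed
  \<comment> \<open>12 = 2 + 4 + 6: the factor \<open>1 - 2 * \<epsilon>\<close>, the fourth power,
    and the six degenerate families.\<close>
  have T_lo: "(1 - 12 * \<theta>) * (d ^ 4 * n ^ 3) \<le> (1 - 2 * \<epsilon>) * (d - \<epsilon>) ^ 4 * n ^ 3 - 6 * n ^ 2"
  proof -
    have "(1 - 6 * \<theta>) * d ^ 4 \<le> ((1 - 2 * \<theta>) * (1 - 4 * \<theta>)) * d ^ 4"
      using sq d by (intro mult_right_mono) (auto simp: algebra_simps)
    also have "\<dots> \<le> ((1 - 2 * \<epsilon>) * (1 - \<theta>) ^ 4) * d ^ 4"
      using bern[of 4] d e0 \<theta> by (intro mult_right_mono mult_mono) auto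
    also have "\<dots> \<le> (1 - 2 * \<epsilon>) * (d - \<epsilon>) ^ 4"
      using mult_left_mono[OF power_mono[OF dm dm0, of 4], of "1 - 2 * \<epsilon>"] e0 \<theta>
      by (simp add: power_mult_distrib mult_ac)
    finally have "(1 - 6 * \<theta>) * d ^ 4 * n ^ 3 \<le> (1 - 2 * \<epsilon>) * (d - \<epsilon>) ^ 4 * n ^ 3"
      using n by (intro mult_right_mono) auto
    moreover have "n ^ 2 * 1 \<le> n ^ 2 * (n * (\<theta> * d ^ 4))"
      using n1 eps by (intro mult_left_mono) auto
    ultimately show ?thesis by (simp add: power2_eq_square power3_eq_cube algebra_simps)
  qed
  have T_hi: "((d + \<epsilon>)\<^sup>2 + 2 * \<epsilon>) * (d + \<epsilon>)\<^sup>2 * n ^ 3 \<le> (1 + 10 * \<theta>) * (d ^ 4 * n ^ 3)"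
  proof -
    have d2: "(d + \<epsilon>)\<^sup>2 \<le> d\<^sup>2 * (1 + 201/100 * \<theta>)"
    proof -
      have "(d + \<epsilon>)\<^sup>2 \<le> (d * (1 + \<theta>))\<^sup>2" using dp d \<epsilon> by (intro power_mono) auto
      also have "\<dots> \<le> d\<^sup>2 * (1 + 201/100 * \<theta>)"
        unfolding power_mult_distrib using p2 by (intro mult_left_mono) auto
      finally show ?thesis .
    qed
    then have "(d + \<epsilon>)\<^sup>2 + 2 * \<epsilon> \<le> d\<^sup>2 * (1 + 401/100 * \<theta>)"
      using eps_le[of 2] by (simp add: algebra_simps)
    then have "((d + \<epsilon>)\<^sup>2 + 2 * \<epsilon>) * (d + \<epsilon>)\<^sup>2 \<le>
        (d\<^sup>2 * (1 + 401/100 * \<theta>)) * (d\<^sup>2 * (1 + 201/100 * \<theta>))"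
      using d2 \<epsilon> \<theta> by (intro mult_mono) auto
    also have "\<dots> = d ^ 4 * ((1 + 401/100 * \<theta>) * (1 + 201/100 * \<theta>))"
      by (simp add: power2_eq_square power4_eq_xxxx)
    also have "\<dots> \<le> d ^ 4 * (1 + 10 * \<theta>)"
    proof (rule mult_left_mono)
      have "(1 + 401/100 * \<theta>) * (1 + 201/100 * \<theta>) = 1 + 602/100 * \<theta> + 80601/10000 * (\<theta> * \<theta>)"
        by (simp add: algebra_simps)
      then show "(1 + 401/100 * \<theta>) * (1 + 201/100 * \<theta>) \<le> 1 + 10 * \<theta>" using sq \<theta> by linarith
    qed (use d in simp)
    finally show ?thesis using n mult_right_mono[of _ _ "n ^ 3"] by (simp add: mult_ac)
  qed
  define s where "s = d ^ 3 * n ^ 2"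
  have s: "0 < s" using d n by (simp add: s_def)
  have t: "d ^ 4 * n ^ 3 = s * (d * n)"
    by (simp add: s_def power2_eq_square power3_eq_cube power4_eq_xxxx)
  have dn: "0 < d * n" using d n by simp
  \<comment> \<open>With \<open>s\<close> for the ideal number of paths, the ideal number of cycles
    is \<open>s * (d * n)\<close>; the factor \<open>s\<close> cancels.\<close>
  have "k * ((1 - 12 * \<theta>) * (s * (d * n))) \<le> (m - k) * ((1 + 7 * \<theta>) * s)"
    using mult_left_mono[OF T_lo k(1)] up mult_left_mono[OF S_hi, of "m - k"] k
    unfolding t s_def[symmetric] by linarith
  then have "k * (1 - 12 * \<theta>) * (d * n) \<le> (m - k) * (1 + 7 * \<theta>)"
    using s by (simp add: mult_ac) 
  also have "\<dots> \<le> m * ((1 + \<delta>) * (1 - 12 * \<theta>))"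
  proof (rule mult_mono)
    have "(1 + 40 * \<theta>) * (1 - 12 * \<theta>) \<le> (1 + \<delta>) * (1 - 12 * \<theta>)"
      using \<delta> \<theta> by (intro mult_right_mono) (auto simp: \<theta>_def)
    moreover have "(1 + 40 * \<theta>) * (1 - 12 * \<theta>) = 1 + 28 * \<theta> - 480 * (\<theta> * \<theta>)"
      by (simp add: algebra_simps)
    ultimately show "1 + 7 * \<theta> \<le> (1 + \<delta>) * (1 - 12 * \<theta>)" using sq \<theta> by linarith
  qed (use k m \<theta> in auto)
  finally have "(k * (d * n)) * (1 - 12 * \<theta>) \<le> (m * (1 + \<delta>)) * (1 - 12 * \<theta>)"
    by (simp add: mult_ac)
  then have upper: "k * (d * n) \<le> m * (1 + \<delta>)" using \<theta> by simp
  have "(m - k) * ((1 - 8 * \<theta>) * s) \<le> k * ((1 + 10 * \<theta>) * (s * (d * n)))"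
    using mult_left_mono[OF T_hi k(1)] lo mult_left_mono[OF S_lo, of "m - k"] k
    unfolding t s_def[symmetric] by linarith
  then have "(m - k) * (1 - 8 * \<theta>) \<le> k * (1 + 10 * \<theta>) * (d * n)"
    using s by (simp add: mult_ac)
  then have "m * (1 - 8 * \<theta>) \<le> k * ((1 + 10 * \<theta>) * (d * n) + (1 - 8 * \<theta>))"
    by (simp add: algebra_simps)
  \<comment> \<open>The extra summand, which comes from having \<open>m - k\<close> in place of
    \<open>m\<close>, is at most \<open>\<theta> * (d * n)\<close>.\<close>
  also have "\<dots> \<le> k * ((1 + 11 * \<theta>) * (d * n))"
  proof (rule mult_left_mono[OF _ k(1)])
    have "1 \<le> n * (\<theta> * d)" using n1 mult_left_mono[OF e1, of n] n(1) by linarith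
    then have "1 \<le> \<theta> * (d * n)" by (simp add: mult_ac)
    then show "(1 + 10 * \<theta>) * (d * n) + (1 - 8 * \<theta>) \<le> (1 + 11 * \<theta>) * (d * n)"
      using \<theta> by (simp add: algebra_simps)
  qed
  finally have *: "m * (1 - 8 * \<theta>) \<le> (k * (d * n)) * (1 + 11 * \<theta>)" by (simp add: mult_ac)
  have "(1 - \<delta>) * (1 + 11 * \<theta>) \<le> (1 - 40 * \<theta>) * (1 + 11 * \<theta>)"
    using \<delta> \<theta> by (intro mult_right_mono) (auto simp: \<theta>_def)
  also have "\<dots> \<le> 1 - 8 * \<theta>" using sq \<theta> by (simp add: algebra_simps)
  finally have "m * ((1 - \<delta>) * (1 + 11 * \<theta>)) \<le> m * (1 - 8 * \<theta>)"
    using m by (intro mult_left_mono) auto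
  with * have "(m * (1 - \<delta>)) * (1 + 11 * \<theta>) \<le> (k * (d * n)) * (1 + 11 * \<theta>)"
    by (simp add: mult_ac)
  then have lower: "m * (1 - \<delta>) \<le> k * (d * n)" using \<theta> by simp
  show ?thesis using upper lower m dn by (simp add: field_simps)
qed

section \<open>The ratio for a fixed edge and the probability\<close>

lemma perfect_matching_edge_ratio:
  fixes E :: "('a \<times> 'b) set"
  assumes sr: "super_regular_pair \<epsilon> d U W E" and card: "card U = n" "card W = n"
    and n: "0 < n" "1 / n \<le> \<epsilon>"
    and \<epsilon>: "0 < \<epsilon>" "\<epsilon> \<le> (d / 40) ^ 5" and d: "0 < d" "d \<le> 1"
    and e: "(u, v) \<in> E"
  shows "perfect_matchings U W E \<noteq> {}"
    and "card (perfect_matchings_containing (u, v) U W E) / card (perfect_matchings U W E) \<in>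
      {(1 - \<epsilon> powr (1/20)) * (1 / (d * n)) .. (1 + \<epsilon> powr (1/20)) * (1 / (d * n))}"
proof -
  have G: "bipartite_graph U W E" using sr by (simp add: super_regular_pair_def regular_pair_def)
  then have fin: "finite U" "finite W" and u: "u \<in> U" and v: "v \<in> W"
    using e by (auto simp: bipartite_graph_def)
  \<comment> \<open>The constant below is \<open>40 ^ 5\<close>; the resulting bound yields both
    smallness conditions in \<open>small\<close>.\<close>
  have "\<epsilon> \<le> d ^ 4 / 100"
  proof -
    have "d ^ 5 \<le> d ^ 4" using d by (intro power_decreasing) auto
    moreover have "\<epsilon> * 102400000 \<le> d ^ 5" using \<epsilon>(2) by (simp add: power_divide)
    moreover have "0 \<le> d ^ 4" using d by simp
    ultimately show ?thesis using \<epsilon>(1) by linarith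
  qed
  moreover have "d ^ 4 \<le> d ^ 1" using d by (intro power_decreasing) auto
  ultimately have small: "\<epsilon> / d ^ 4 \<le> 1/100" "2 * \<epsilon> < d" using d by (auto simp: field_simps)
  define F where "F = matching_bijections U W E"
  define Fe where "Fe = {\<sigma>\<in>F. \<sigma> u = v}"
  define Fn where "Fn = {\<sigma>\<in>F. \<sigma> u \<noteq> v}"
  have "F \<noteq> {}" unfolding F_def
    using matching_bijections_nonempty[OF sr] card u \<epsilon> d small by auto
  have finF: "finite F" unfolding F_def using fin by (rule finite_matching_bijections)
  note bij = bij_betw_perfect_matchings[OF G, folded F_def]
  show "perfect_matchings U W E \<noteq> {}" using bij \<open>F \<noteq> {}\<close> by (auto simp: bij_betw_def)
  have cF: "card (perfect_matchings U W E) = card F" using bij by (rule bij_betw_same_card)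
  have "bij_betw (\<lambda>M. restrict (matching_fun M) U) (perfect_matchings_containing (u, v) U W E) Fe"
  proof (rule bij_betw_subset[OF bij])
    have iff: "restrict (matching_fun M) U u = v \<longleftrightarrow> (u, v) \<in> M" if "M \<in> perfect_matchings U W E" for M
      using matching_fun_bij_betw(2)[OF G that u] u by simp
    show "(\<lambda>M. restrict (matching_fun M) U) ` perfect_matchings_containing (u, v) U W E = Fe"
      unfolding Fe_def perfect_matchings_containing_def bij_betw_imp_surj_on[OF bij, symmetric]
      using iff by blast
  qed (auto simp: perfect_matchings_containing_def)
  then have cFe: "card (perfect_matchings_containing (u, v) U W E) = card Fe"
    by (rule bij_betw_same_card)
  have "F = Fe \<union> Fn" "Fe \<inter> Fn = {}" by (auto simp: Fe_def Fn_def)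
  then have cFn: "real (card Fn) = real (card F) - card Fe"
    using finF by (metis add_diff_cancel_left' card_Un_disjoint finite_Un of_nat_add)
  have D: "super_regular_digraph U (\<lambda>x y. (x, \<sigma> y) \<in> E) \<epsilon> d" and inj: "bij_betw \<sigma> U W" if "\<sigma> \<in> F" for \<sigma>
    using that super_regular_digraph_bijection[OF sr] card u \<epsilon> d small
    by (auto simp: F_def matching_bijections_def)
  define T where "T \<sigma> = real (card (four_cycles U (\<lambda>x y. (x, \<sigma> y) \<in> E) u))" for \<sigma>
  define S where "S \<sigma> = real (card (three_paths U (\<lambda>x y. (x, \<sigma> y) \<in> E) (inv_into U \<sigma> v) u))" for \<sigma>
  have "(\<Sum>\<sigma>\<in>Fe. T \<sigma>) = real (\<Sum>\<sigma>\<in>Fe. card (four_cycles U (\<lambda>x y. (x, \<sigma> y) \<in> E) u))"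
    by (simp add: T_def)
  also have "\<dots> = real (\<Sum>\<sigma>\<in>Fn. card (three_paths U (\<lambda>x y. (x, \<sigma> y) \<in> E) (inv_into U \<sigma> v) u))"
    unfolding Fe_def Fn_def F_def sum_four_cycles_eq_sum_three_paths[OF fin e u v] ..
  also have "\<dots> = (\<Sum>\<sigma>\<in>Fn. S \<sigma>)" by (simp add: S_def)
  finally have double: "(\<Sum>\<sigma>\<in>Fe. T \<sigma>) = (\<Sum>\<sigma>\<in>Fn. S \<sigma>)" .
  have T: "T \<sigma> \<in> {(1 - 2 * \<epsilon>) * (d - \<epsilon>) ^ 4 * real n ^ 3 - 6 * real n ^ 2 ..
     ((d + \<epsilon>)\<^sup>2 + 2 * \<epsilon>) * (d + \<epsilon>)\<^sup>2 * real n ^ 3}" if "\<sigma> \<in> Fe" for \<sigma>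
    using super_regular_digraph.card_four_cycles[OF D u, of \<sigma>] that unfolding T_def card Fe_def by blast
  have S: "S \<sigma> \<in> {(d - \<epsilon>) ^ 3 * real n ^ 2 - 5 * real n .. (d + \<epsilon>) ^ 3 * real n ^ 2}" if "\<sigma> \<in> Fn" for \<sigma>
  proof -
    have \<sigma>: "\<sigma> \<in> F" "\<sigma> u \<noteq> v" using that by (auto simp: Fn_def)
    then have "v \<in> \<sigma> ` U" using inj v by (simp add: bij_betw_def)
    \<comment> \<open>The start \<open>c\<close> of the paths differs from \<open>u\<close> because
      \<open>\<sigma>\<close> sends it to \<open>v\<close> but does not send \<open>u\<close>
      there.\<close>
    then have "inv_into U \<sigma> v \<in> U" "\<sigma> (inv_into U \<sigma> v) = v" by (rule inv_into_into, rule f_inv_into_f)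
    then show ?thesis
      using super_regular_digraph.card_three_paths[OF D[OF \<sigma>(1)] u] \<sigma>(2) unfolding S_def card by metis
  qed
  show "card (perfect_matchings_containing (u, v) U W E) / card (perfect_matchings U W E) \<in>
      {(1 - \<epsilon> powr (1/20)) * (1 / (d * n)) .. (1 + \<epsilon> powr (1/20)) * (1 / (d * n))}"
    unfolding cF cFe
  \<comment> \<open>Bounding both sides of \<open>double\<close> termwise gives the two
    inequalities, with \<open>k = card Fe\<close> and \<open>m = card F\<close>.\<close>
  proof (rule edge_ratio_bounds[OF \<epsilon>(1) d])
    show "real (card Fe) \<le> card F" using finF by (simp add: Fe_def card_mono)
    show "0 < real (card F)" using finF \<open>F \<noteq> {}\<close> by (simp add: card_gt_0_iff)
    have "card Fe * ((1 - 2 * \<epsilon>) * (d - \<epsilon>) ^ 4 * real n ^ 3 - 6 * real n ^ 2) \<le> (\<Sum>\<sigma>\<in>Fe. T \<sigma>)"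
      using T by (intro sum_bounded_below) auto
    also have "\<dots> \<le> card Fn * ((d + \<epsilon>) ^ 3 * real n ^ 2)"
      unfolding double using S by (intro sum_bounded_above) auto
    finally show "card Fe * ((1 - 2 * \<epsilon>) * (d - \<epsilon>) ^ 4 * real n ^ 3 - 6 * real n ^ 2) \<le>
        (real (card F) - card Fe) * ((d + \<epsilon>) ^ 3 * real n ^ 2)" by (simp only: cFn)
    have "card Fn * ((d - \<epsilon>) ^ 3 * real n ^ 2 - 5 * real n) \<le> (\<Sum>\<sigma>\<in>Fn. S \<sigma>)"
      using S by (intro sum_bounded_below) auto
    also have "\<dots> \<le> card Fe * (((d + \<epsilon>)\<^sup>2 + 2 * \<epsilon>) * (d + \<epsilon>)\<^sup>2 * real n ^ 3)"
      unfolding double[symmetric] using T by (intro sum_bounded_above) auto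
    finally show "(real (card F) - card Fe) * ((d - \<epsilon>) ^ 3 * real n ^ 2 - 5 * real n) \<le>
        card Fe * (((d + \<epsilon>)\<^sup>2 + 2 * \<epsilon>) * (d + \<epsilon>)\<^sup>2 * real n ^ 3)" by (simp only: cFn)
    show "40 * (\<epsilon> / d ^ 4) \<le> \<epsilon> powr (1/20)" using \<epsilon> d by (rule eps_powr_bound)
  qed (use n small in auto)
qed

theorem theorem4p3:
  shows "\<exists>(f :: real \<Rightarrow> real) (g :: real \<Rightarrow> real \<Rightarrow> real).
    (\<forall>x\<in>{0<..1}. f x \<in> {0<..1}) \<and> mono_on {0<..1} f \<and>
    (\<forall>x\<in>{0<..1}. \<forall>y\<in>{0<..1}. g x y \<in> {0<..1}) \<and>
    (\<forall>x\<in>{0<..1}. \<forall>x'\<in>{0<..1}. \<forall>y\<in>{0<..1}. \<forall>y'\<in>{0<..1}.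
       x \<le> x' \<and> y \<le> y' \<longrightarrow> g x y \<le> g x' y') \<and>
    (\<forall>(n :: nat) (\<epsilon> :: real) (d :: real) (U :: 'a set) (W :: 'b set) (E :: ('a \<times> 'b) set).
       0 < n \<and> 1 / real n \<le> g \<epsilon> d \<and> 0 < \<epsilon> \<and> \<epsilon> \<le> f d \<and> 0 < d \<and> d \<le> 1 \<and>
       super_regular_pair \<epsilon> d U W E \<and> card U = n \<and> card W = n \<longrightarrow>
       (\<forall>e\<in>E.
          real (card (perfect_matchings_containing e U W E)) / real (card (perfect_matchings U W E))
            \<in> {(1 - \<epsilon> powr (1/20)) * (1 / (d * real n)) .. (1 + \<epsilon> powr (1/20)) * (1 / (d * real n))}) \<and>
       (\<forall>u\<in>U. \<forall>v\<in>W. (u, v) \<in> E \<longrightarrow>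
          measure_pmf.prob (pmf_of_set (perfect_matchings U W E)) {\<sigma>. matching_fun \<sigma> u = v}
            \<in> {(1 - \<epsilon> powr (1/20)) * (1 / (d * real n)) .. (1 + \<epsilon> powr (1/20)) * (1 / (d * real n))}))"
proof (intro exI[of _ "\<lambda>x. (x / 40) ^ 5"] exI[of _ "\<lambda>x y. x"] conjI allI impI)
  \<comment> \<open>The witness \<open>(x / 40) ^ 5\<close> is what the power estimate requires;
    taking \<open>\<epsilon>\<close> itself as the bound on \<open>1 / n\<close> makes lower-order
    terms absorbable.\<close>
  show "\<forall>x\<in>{0<..1}. (x / 40) ^ 5 \<in> {0<..1::real}"
    by (auto intro!: power_le_one)
  show "mono_on {0<..1} (\<lambda>x::real. (x / 40) ^ 5)"
    by (intro mono_onI power_mono) auto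
next
  fix n :: nat and \<epsilon> d :: real and U :: "'a set" and W :: "'b set" and E :: "('a \<times> 'b) set"
  assume H: "0 < n \<and> 1 / real n \<le> \<epsilon> \<and> 0 < \<epsilon> \<and> \<epsilon> \<le> (d / 40) ^ 5 \<and> 0 < d \<and> d \<le> 1 \<and>
       super_regular_pair \<epsilon> d U W E \<and> card U = n \<and> card W = n"
  let ?I = "{(1 - \<epsilon> powr (1/20)) * (1 / (d * real n)) .. (1 + \<epsilon> powr (1/20)) * (1 / (d * real n))}"
  let ?M = "perfect_matchings U W E"
  \<comment> \<open>Non-emptiness is what gives \<open>pmf_of_set\<close> and the quotient their
    intended meaning; it is available as soon as there is an edge.\<close>
  have ne: "?M \<noteq> {}"
    and ratio: "real (card (perfect_matchings_containing (u, v) U W E)) / card ?M \<in> ?I"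
    if "(u, v) \<in> E" for u v
    using perfect_matching_edge_ratio[of \<epsilon> d U W E n u v] H that by auto
  show "\<forall>e\<in>E. real (card (perfect_matchings_containing e U W E)) / card ?M \<in> ?I"
    using ratio by auto
  have G: "bipartite_graph U W E" using H by (simp add: super_regular_pair_def regular_pair_def)
  have "finite E" using G finite_subset by (auto simp: bipartite_graph_def)
  then have fin: "finite ?M"
    by (rule finite_subset[rotated, OF finite_Pow_iff[THEN iffD2]]) (auto simp: perfect_matchings_def)
  show "\<forall>u\<in>U. \<forall>v\<in>W. (u, v) \<in> E \<longrightarrow>
      measure_pmf.prob (pmf_of_set ?M) {\<sigma>. matching_fun \<sigma> u = v} \<in> ?I"
  proof (intro ballI impI)
    fix u v assume uv: "u \<in> U" "v \<in> W" "(u, v) \<in> E"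
    have "?M \<inter> {\<sigma>. matching_fun \<sigma> u = v} = perfect_matchings_containing (u, v) U W E"
      using matching_fun_bij_betw(2)[OF G _ uv(1)] by (auto simp: perfect_matchings_containing_def)
    then show "measure_pmf.prob (pmf_of_set ?M) {\<sigma>. matching_fun \<sigma> u = v} \<in> ?I"
      using ratio[OF uv(3)] by (simp add: measure_pmf_of_set[OF ne[OF uv(3)] fin])
  qed
qed auto

end
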